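(* Let $T>0$, let $F^0,F^1,F^2:[0,T]\times\mathbb R\to\mathbb R$ be (deterministic) measurable functions, let $h^0,h^1,h^2,C^1,C^2\in\mathbb R$, and let $c^1,c^2$ be (deterministic) functions on $[0,T]$. Consider on $[0,T]$ the backward ODEs $$\mathbf y^0_t=h^0+\int_t^TF^0(s,\mathbf y^0_s)\,ds,\tag{1}$$ $$\mathbf y^1_t=h^1-C^1+\int_t^T[F^1(s,\mathbf y^1_s)+c^1_s]\,ds,\qquad\mathbf y^2_t=h^2+C^2+\int_t^T[F^2(s,\mathbf y_s^2)-c_s^2]\,ds.\tag{2}$$ Assume that: (i) $h^1\le h^0\le h^2$ and $F^1\le F^0\le F^2$; (ii) both ODEs in (2) admit bounded solutions $\mathbf y^1$ and $\mathbf y^2$ on $[0,T]$; (iii) for each $t\in[0,T]$, the functions $y\mapsto F^i(t,y)$, $i=0,1,2$, are uniformly Lipschitz continuous for $y\in[\mathbf y^1_t,\mathbf y^2_t]$, with a common Lipschitz constant $L$; (iv) for $i=1,2$, $C^i\ge\int_t^Te^{-\int_s^T\alpha_r\,dr}c^i_s\,ds$ for all $t\in[0,T]$ and all $\alpha$ satisfying $|\alpha|\le L$. Then (1) has a unique solution $\mathbf y^0$ satisfying $\mathbf y^1\le\mathbf y^0\le\mathbf y^2$.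
   Context: All functions are deterministic; $\alpha$ in (iv) ranges over measurable functions on $[0,T]$, and $c^1,c^2$ are integrable on $[0,T]$, so that the integrals make sense. *)

theory Defs
  imports "HOL-Analysis.Analysis"
begin

text \<open>
  Functions on \<open>[0,T]\<close> are total functions on the reals whose values outside \<open>{0..T}\<close> are
  never used; integrals are Lebesgue integrals. A solution of
  \<open>y t = h + \<integral>\<^sub>t\<^sup>T G s (y s) ds\<close> satisfies the equation at every \<open>t \<in> {0..T}\<close> and has an
  integrable driver along its path. The integrability clause is needed because the Bochner
  integral of a non-integrable function is \<open>0\<close>. Solutions are automatically continuous, hence
  measurable.
\<close>

definition backward_ode_solution ::
    "real \<Rightarrow> (real \<Rightarrow> real \<Rightarrow> real) \<Rightarrow> real \<Rightarrow> (real \<Rightarrow> real) \<Rightarrow> bool" where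
  "backward_ode_solution T G h y \<longleftrightarrow>
     set_integrable lebesgue {0..T} (\<lambda>s. G s (y s)) \<and>
     (\<forall>t\<in>{0..T}. y t = h + (LINT s:{t..T}|lebesgue. G s (y s)))"

end

theory Submission
  imports Defs
begin

text \<open>
  If \<open>y t = k + \<integral>\<^sub>t\<^sup>T w\<close> and \<open>w = \<alpha> y + q\<close>, then \<open>exp (- \<integral>\<^sub>t\<^sup>T \<alpha>) y t = k + \<integral>\<^sub>t\<^sup>T exp (- \<integral>\<^sub>s\<^sup>T \<alpha>) q s ds\<close>.
  For the difference of two solutions the Lipschitz condition provides such an \<open>\<alpha>\<close> with
  \<open>\<bar>\<alpha>\<bar> \<le> L\<close> and \<open>q\<close> at least \<open>- c\<close>, and the lower bound on the constants \<open>C\<close> makes the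
  right-hand side nonnegative. This gives \<open>y1 \<le> y2\<close>. Truncating the argument of \<open>F0\<close> to
  \<open>[y1 t, y2 t]\<close> yields a globally Lipschitz driver, whose equation is solved by the Banach fixed
  point theorem; comparing its solution with \<open>y1\<close> and \<open>y2\<close> shows that the truncation is never
  active, and comparing two solutions with each other gives uniqueness. As the drivers are merely
  integrable, the product and chain rules are needed for absolutely continuous functions; they are
  obtained directly from the integral representation, without differentiating almost everywhere.
\<close>

subsection \<open>Calculus of indefinite Lebesgue integrals\<close>

definition primitive_on :: "real \<Rightarrow> real \<Rightarrow> (real \<Rightarrow> real) \<Rightarrow> (real \<Rightarrow> real) \<Rightarrow> bool" where
  "primitive_on a b f f' \<longleftrightarrow> f' absolutely_integrable_on {a..b} \<and>
     (\<forall>s t. a \<le> s \<longrightarrow> s \<le> t \<longrightarrow> t \<le> b \<longrightarrow> f t - f s = integral {s..t} f')"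

lemma primitive_on_integrable:
  assumes "primitive_on a b f f'" "a \<le> s" "t \<le> b"
  shows "f' absolutely_integrable_on {s..t}" "f' integrable_on {s..t}"
proof -
  show "f' absolutely_integrable_on {s..t}"
    using assms by (auto simp: primitive_on_def intro: absolutely_integrable_on_subinterval)
  then show "f' integrable_on {s..t}" by (rule set_lebesgue_integral_eq_integral)
qed

lemma primitive_on_diff:
  "primitive_on a b f f' \<Longrightarrow> a \<le> s \<Longrightarrow> s \<le> t \<Longrightarrow> t \<le> b \<Longrightarrow> f t - f s = integral {s..t} f'"
  by (auto simp: primitive_on_def)

lemma primitive_on_continuous:
  assumes "primitive_on a b f f'"
  shows "continuous_on {a..b} f"
proof -
  have "continuous_on {a..b} (\<lambda>x. f a + integral {a..x} f')"
    using primitive_on_integrable[OF assms]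
    by (intro continuous_intros indefinite_integral_continuous_1) auto
  moreover have "f x = f a + integral {a..x} f'" if "x \<in> {a..b}" for x
    using primitive_on_diff[OF assms, of a x] that by simp
  ultimately show ?thesis by (metis (no_types, lifting) continuous_on_cong)
qed

lemma primitive_on_backward:
  fixes w y :: "real \<Rightarrow> real"
  assumes "w absolutely_integrable_on {a..b}" "\<And>t. t \<in> {a..b} \<Longrightarrow> y t = k + integral {t..b} w"
  shows "primitive_on a b y (\<lambda>s. - w s)"
  unfolding primitive_on_def
proof (intro conjI allI impI)
  show "(\<lambda>s. - w s) absolutely_integrable_on {a..b}"
    using set_integrable_mult_right[of "-1" lebesgue _ w] assms(1) by simp
  fix s t assume st: "a \<le> s" "s \<le> t" "t \<le> b"
  have "w integrable_on {s..b}"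
    using assms(1) st absolutely_integrable_on_subinterval[of "{a..b}" _ s b]
    by (intro set_lebesgue_integral_eq_integral(1)) auto
  then have "integral {s..t} w + integral {t..b} w = integral {s..b} w"
    using st by (intro Henstock_Kurzweil_Integration.integral_combine) auto
  then show "y t - y s = integral {s..t} (\<lambda>s. - w s)"
    using assms(2)[of s] assms(2)[of t] st by simp
qed

text \<open>Local errors are summed along a fine subdivision, which is the content of Bolzano's lemma.\<close>

lemma primitive_onI_local:
  assumes f': "f' absolutely_integrable_on {a..b}"
    and p: "p absolutely_integrable_on {a..b}"
    and loc: "\<And>e x. 0 < e \<Longrightarrow> x \<in> {a..b} \<Longrightarrow> \<exists>d>0. \<forall>s t. a \<le> s \<longrightarrow> s \<le> x \<longrightarrow> x \<le> t \<longrightarrow> t \<le> b \<longrightarrow> t - s < d \<longrightarrow>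
      (\<exists>v. v integrable_on {s..t} \<and> f t - f s = integral {s..t} v \<and> (\<forall>r\<in>{s..t}. \<bar>v r - f' r\<bar> \<le> e * p r))"
  shows "primitive_on a b f f'"
  unfolding primitive_on_def
proof (intro conjI allI impI f')
  fix l u assume lu: "a \<le> l" "l \<le> u" "u \<le> b"
  have f'I: "f' integrable_on {s..t}" if "a \<le> s" "t \<le> b" for s t
    using that f' absolutely_integrable_on_subinterval[of "{a..b}" _ s t]
    by (intro set_lebesgue_integral_eq_integral(1)) auto
  have pI: "p integrable_on {s..t}" if "a \<le> s" "t \<le> b" for s t
    using that p absolutely_integrable_on_subinterval[of "{a..b}" _ s t]
    by (intro set_lebesgue_integral_eq_integral(1)) auto
  define P where "P e s t \<longleftrightarrow> (a \<le> s \<longrightarrow> t \<le> b \<longrightarrow>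
      \<bar>f t - f s - integral {s..t} f'\<bar> \<le> e * integral {s..t} p)" for e s t
  have "P e l u" if "0 < e" for e
    using lu(2)
  proof (induction rule: Bolzano)
    case (trans r s t)
    show ?case
      unfolding P_def
    proof (intro impI)
      assume rt: "a \<le> r" "t \<le> b"
      have "integral {r..s} f' + integral {s..t} f' = integral {r..t} f'"
        "integral {r..s} p + integral {s..t} p = integral {r..t} p"
        using rt trans(3,4) f'I pI by (auto intro!: Henstock_Kurzweil_Integration.integral_combine)
      moreover from this have "e * integral {r..t} p = e * integral {r..s} p + e * integral {s..t} p"
        by (metis distrib_left)
      ultimately show "\<bar>f t - f r - integral {r..t} f'\<bar> \<le> e * integral {r..t} p"
        using trans rt unfolding P_def by linarith
    qed
  next
    case (local x)
    then obtain d where "d > 0" and d: "\<And>s t. \<lbrakk>a \<le> s; s \<le> x; x \<le> t; t \<le> b; t - s < d\<rbrakk> \<Longrightarrow>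
      (\<exists>v. v integrable_on {s..t} \<and> f t - f s = integral {s..t} v \<and> (\<forall>r\<in>{s..t}. \<bar>v r - f' r\<bar> \<le> e * p r))"
      using loc[OF \<open>0 < e\<close>, of x] lu by auto
    have "P e s t" if st: "s \<le> x \<and> x \<le> t \<and> t - s < d" for s t
      unfolding P_def
    proof (intro impI)
      assume ab: "a \<le> s" "t \<le> b"
      then obtain v where v: "v integrable_on {s..t}" "f t - f s = integral {s..t} v"
          "\<And>r. r \<in> {s..t} \<Longrightarrow> \<bar>v r - f' r\<bar> \<le> e * p r"
        using d st by blast
      have "norm (integral {s..t} (\<lambda>r. v r - f' r)) \<le> integral {s..t} (\<lambda>r. e * p r)"
        using v f'I[OF ab] pI[OF ab]
        by (intro Henstock_Kurzweil_Integration.integral_norm_bound_integral integrable_diff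
            integrable_on_mult_right) auto
      then show "\<bar>f t - f s - integral {s..t} f'\<bar> \<le> e * integral {s..t} p"
        using v f'I[OF ab] by (simp add: Henstock_Kurzweil_Integration.integral_diff)
    qed
    then show ?case using \<open>d > 0\<close> by blast
  qed
  then have bd: "\<bar>f u - f l - integral {l..u} f'\<bar> \<le> e * integral {l..u} p" if "0 < e" for e
    using that lu by (auto simp: P_def)
  have "\<bar>f u - f l - integral {l..u} f'\<bar> \<le> 0"
  proof (rule field_le_epsilon)
    fix e :: real assume "0 < e"
    define c where "c = e / (1 + \<bar>integral {l..u} p\<bar>)"
    have c: "0 < c" "c * (1 + \<bar>integral {l..u} p\<bar>) = e"
      using \<open>0 < e\<close> by (auto simp: c_def add_pos_nonneg)
    have "c * integral {l..u} p \<le> c * (1 + \<bar>integral {l..u} p\<bar>)"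
      using c by (intro mult_left_mono) auto
    then show "\<bar>f u - f l - integral {l..u} f'\<bar> \<le> 0 + e" using bd[OF c(1)] c by simp
  qed
  then show "f u - f l = integral {l..u} f'" by simp
qed

lemma absolutely_integrable_continuous_mult:
  fixes f g :: "real \<Rightarrow> real"
  assumes "continuous_on {a..b} f" "g absolutely_integrable_on {a..b}"
  shows "(\<lambda>x. f x * g x) absolutely_integrable_on {a..b}"
  using assms
  by (intro absolutely_integrable_bounded_measurable_product_real)
    (auto intro: continuous_imp_measurable_on_sets_lebesgue compact_imp_bounded compact_continuous_image)

lemma continuous_on_interval_close:
  fixes f :: "real \<Rightarrow> real"
  assumes "continuous_on {a..b} f" "x \<in> {a..b}" "0 < e"
  obtains d where "0 < d" "\<And>s t. a \<le> s \<Longrightarrow> s \<le> x \<Longrightarrow> x \<le> t \<Longrightarrow> t \<le> b \<Longrightarrow> t - s < d \<Longrightarrow> (\<forall>r\<in>{s..t}. \<bar>f r - f x\<bar> < e)"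
proof -
  obtain d where "0 < d" "\<And>r. r \<in> {a..b} \<Longrightarrow> dist r x < d \<Longrightarrow> dist (f r) (f x) < e"
    using assms unfolding continuous_on_iff by meson
  then show ?thesis
    by (intro that[of d]) (auto simp: dist_real_def)
qed

lemma primitive_on_mult:
  assumes f: "primitive_on a b f f'" and g: "primitive_on a b g g'"
  shows "primitive_on a b (\<lambda>t. f t * g t) (\<lambda>t. g t * f' t + f t * g' t)"
proof (rule primitive_onI_local[where p = "\<lambda>r. \<bar>f' r\<bar> + \<bar>g' r\<bar>"])
  note I = primitive_on_integrable[OF f] primitive_on_integrable[OF g]
  show "(\<lambda>t. g t * f' t + f t * g' t) absolutely_integrable_on {a..b}"
    using primitive_on_continuous f g I
    by (intro set_integral_add(1) absolutely_integrable_continuous_mult) auto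
  show "(\<lambda>r. \<bar>f' r\<bar> + \<bar>g' r\<bar>) absolutely_integrable_on {a..b}"
    using I by (intro set_integral_add(1) set_integrable_abs) auto
  fix e x :: real assume e: "0 < e" and x: "x \<in> {a..b}"
  obtain d1 where d1: "0 < d1" "\<And>s t. \<lbrakk>a \<le> s; s \<le> x; x \<le> t; t \<le> b; t - s < d1\<rbrakk> \<Longrightarrow> \<forall>r\<in>{s..t}. \<bar>f r - f x\<bar> < e / 2"
    using continuous_on_interval_close[OF primitive_on_continuous[OF f] x, of "e/2"] e by auto
  obtain d2 where d2: "0 < d2" "\<And>s t. \<lbrakk>a \<le> s; s \<le> x; x \<le> t; t \<le> b; t - s < d2\<rbrakk> \<Longrightarrow> \<forall>r\<in>{s..t}. \<bar>g r - g x\<bar> < e / 2"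
    using continuous_on_interval_close[OF primitive_on_continuous[OF g] x, of "e/2"] e by auto
  show "\<exists>d>0. \<forall>s t. a \<le> s \<longrightarrow> s \<le> x \<longrightarrow> x \<le> t \<longrightarrow> t \<le> b \<longrightarrow> t - s < d \<longrightarrow>
      (\<exists>v. v integrable_on {s..t} \<and> f t * g t - f s * g s = integral {s..t} v \<and>
        (\<forall>r\<in>{s..t}. \<bar>v r - (g r * f' r + f r * g' r)\<bar> \<le> e * (\<bar>f' r\<bar> + \<bar>g' r\<bar>)))"
  proof (intro exI[of _ "min d1 d2"] conjI allI impI)
    fix s t assume st: "a \<le> s" "s \<le> x" "x \<le> t" "t \<le> b" "t - s < min d1 d2"
    have int: "f' integrable_on {s..t}" "g' integrable_on {s..t}" using I st by auto
    have nf: "\<bar>f r - f x\<bar> < e / 2" and ng: "\<bar>g r - g x\<bar> < e / 2" if "r \<in> {s..t}" for r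
      using d1(2)[of s t] d2(2)[of s t] st that by auto
    show "\<exists>v. v integrable_on {s..t} \<and> f t * g t - f s * g s = integral {s..t} v \<and>
        (\<forall>r\<in>{s..t}. \<bar>v r - (g r * f' r + f r * g' r)\<bar> \<le> e * (\<bar>f' r\<bar> + \<bar>g' r\<bar>))"
    proof (intro exI[of _ "\<lambda>r. g t * f' r + f s * g' r"] conjI ballI)
      show "(\<lambda>r. g t * f' r + f s * g' r) integrable_on {s..t}"
        using int by (intro integrable_add integrable_on_mult_right)
      have "integral {s..t} (\<lambda>r. g t * f' r + f s * g' r) = g t * (f t - f s) + f s * (g t - g s)"
        using int st primitive_on_diff[OF f, of s t] primitive_on_diff[OF g, of s t]
        by (simp add: Henstock_Kurzweil_Integration.integral_add integrable_on_mult_right)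
      then show "f t * g t - f s * g s = integral {s..t} (\<lambda>r. g t * f' r + f s * g' r)"
        by (simp add: algebra_simps)
      fix r assume r: "r \<in> {s..t}"
      have "\<bar>g t * f' r + f s * g' r - (g r * f' r + f r * g' r)\<bar> = \<bar>(g t - g r) * f' r + (f s - f r) * g' r\<bar>"
        by (simp add: algebra_simps)
      also have "\<dots> \<le> \<bar>g t - g r\<bar> * \<bar>f' r\<bar> + \<bar>f s - f r\<bar> * \<bar>g' r\<bar>"
        by (metis abs_mult abs_triangle_ineq)
      also have "\<dots> \<le> e * \<bar>f' r\<bar> + e * \<bar>g' r\<bar>"
      proof (intro add_mono mult_right_mono)
        have "\<bar>g t - g x\<bar> < e / 2" using ng[of t] st by auto
        then show "\<bar>g t - g r\<bar> \<le> e" using ng[OF r] by linarith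
        have "\<bar>f s - f x\<bar> < e / 2" using nf[of s] st by auto
        then show "\<bar>f s - f r\<bar> \<le> e" using nf[OF r] by linarith
      qed auto
      finally show "\<bar>g t * f' r + f s * g' r - (g r * f' r + f r * g' r)\<bar> \<le> e * (\<bar>f' r\<bar> + \<bar>g' r\<bar>)"
        by (simp add: algebra_simps)
    qed
  qed (use d1 d2 in auto)
qed

lemma primitive_on_chain:
  assumes f: "primitive_on a b f f'"
    and \<phi>: "\<And>y. (\<phi> has_real_derivative \<phi>' y) (at y)" and \<phi>': "continuous_on UNIV \<phi>'"
  shows "primitive_on a b (\<lambda>t. \<phi> (f t)) (\<lambda>t. \<phi>' (f t) * f' t)"
proof (rule primitive_onI_local[where p = "\<lambda>r. \<bar>f' r\<bar>"])
  note I = primitive_on_integrable[OF f]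
  show "(\<lambda>t. \<phi>' (f t) * f' t) absolutely_integrable_on {a..b}"
    using I by (intro absolutely_integrable_continuous_mult continuous_on_compose2[OF \<phi>'] primitive_on_continuous[OF f]) auto
  show "(\<lambda>r. \<bar>f' r\<bar>) absolutely_integrable_on {a..b}"
    using I by (intro set_integrable_abs) auto
  fix e x :: real assume e: "0 < e" and x: "x \<in> {a..b}"
  obtain \<eta> where \<eta>: "\<eta> > 0" "\<And>y. \<bar>y - f x\<bar> < \<eta> \<Longrightarrow> \<bar>\<phi>' y - \<phi>' (f x)\<bar> < e / 2"
    using \<phi>' e unfolding continuous_on_iff dist_real_def by (meson UNIV_I half_gt_zero)
  obtain d where d: "0 < d" "\<And>s t. \<lbrakk>a \<le> s; s \<le> x; x \<le> t; t \<le> b; t - s < d\<rbrakk> \<Longrightarrow> \<forall>r\<in>{s..t}. \<bar>f r - f x\<bar> < \<eta>"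
    using continuous_on_interval_close[OF primitive_on_continuous[OF f] x \<eta>(1)] by auto
  show "\<exists>d>0. \<forall>s t. a \<le> s \<longrightarrow> s \<le> x \<longrightarrow> x \<le> t \<longrightarrow> t \<le> b \<longrightarrow> t - s < d \<longrightarrow>
      (\<exists>v. v integrable_on {s..t} \<and> \<phi> (f t) - \<phi> (f s) = integral {s..t} v \<and>
        (\<forall>r\<in>{s..t}. \<bar>v r - \<phi>' (f r) * f' r\<bar> \<le> e * \<bar>f' r\<bar>))"
  proof (intro exI[of _ d] conjI allI impI d(1))
    fix s t assume st: "a \<le> s" "s \<le> x" "x \<le> t" "t \<le> b" "t - s < d"
    have int: "f' integrable_on {s..t}" using I st by auto
    have nf: "\<bar>f r - f x\<bar> < \<eta>" if "r \<in> {s..t}" for r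
      using d(2)[of s t] st that by auto
    have "\<exists>\<xi>. \<phi> (f t) - \<phi> (f s) = \<phi>' \<xi> * (f t - f s) \<and> \<bar>\<xi> - f x\<bar> < \<eta>"
    proof (cases "f s" "f t" rule: linorder_cases)
      case less
      from MVT2[OF this, of \<phi> \<phi>'] \<phi> obtain z where "f s < z" "z < f t" "\<phi> (f t) - \<phi> (f s) = (f t - f s) * \<phi>' z"
        by auto
      then show ?thesis using nf[of s] nf[of t] st by (intro exI[of _ z]) auto
    next
      case equal
      then show ?thesis using \<eta> by (intro exI[of _ "f x"]) auto
    next
      case greater
      from MVT2[OF this, of \<phi> \<phi>'] \<phi> obtain z where "f t < z" "z < f s" "\<phi> (f s) - \<phi> (f t) = (f s - f t) * \<phi>' z"
        by auto
      then show ?thesis using nf[of s] nf[of t] st by (intro exI[of _ z]) (auto simp: algebra_simps)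
    qed
    then obtain \<xi> where \<xi>: "\<phi> (f t) - \<phi> (f s) = \<phi>' \<xi> * (f t - f s)" "\<bar>\<xi> - f x\<bar> < \<eta>" by blast
    show "\<exists>v. v integrable_on {s..t} \<and> \<phi> (f t) - \<phi> (f s) = integral {s..t} v \<and>
        (\<forall>r\<in>{s..t}. \<bar>v r - \<phi>' (f r) * f' r\<bar> \<le> e * \<bar>f' r\<bar>)"
    proof (intro exI[of _ "\<lambda>r. \<phi>' \<xi> * f' r"] conjI ballI)
      show "(\<lambda>r. \<phi>' \<xi> * f' r) integrable_on {s..t}"
        using int by (intro integrable_on_mult_right)
      show "\<phi> (f t) - \<phi> (f s) = integral {s..t} (\<lambda>r. \<phi>' \<xi> * f' r)"
        using \<xi> st primitive_on_diff[OF f, of s t] by simp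
      fix r assume r: "r \<in> {s..t}"
      have "\<bar>\<phi>' \<xi> * f' r - \<phi>' (f r) * f' r\<bar> = \<bar>\<phi>' \<xi> - \<phi>' (f r)\<bar> * \<bar>f' r\<bar>"
        by (simp add: abs_mult flip: left_diff_distrib)
      also have "\<dots> \<le> e * \<bar>f' r\<bar>"
        using \<eta>(2)[OF \<xi>(2)] \<eta>(2)[OF nf[OF r]] by (intro mult_right_mono; linarith)
      finally show "\<bar>\<phi>' \<xi> * f' r - \<phi>' (f r) * f' r\<bar> \<le> e * \<bar>f' r\<bar>" .
    qed
  qed
qed

lemma backward_linear_formula:
  fixes a b k :: real and w y \<alpha> :: "real \<Rightarrow> real"
  assumes w: "w absolutely_integrable_on {a..b}"
    and y: "\<And>t. t \<in> {a..b} \<Longrightarrow> y t = k + integral {t..b} w"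
    and \<alpha>: "\<alpha> absolutely_integrable_on {a..b}"
    and t: "t \<in> {a..b}"
  shows "exp (- integral {t..b} \<alpha>) * y t = k + integral {t..b} (\<lambda>s. exp (- integral {s..b} \<alpha>) * (w s - \<alpha> s * y s))"
proof -
  have "(\<lambda>s. - \<alpha> s) absolutely_integrable_on {a..b}"
    using set_integrable_mult_right[of "-1" lebesgue _ \<alpha>] \<alpha> by simp
  then have A: "primitive_on a b (\<lambda>t. - integral {t..b} \<alpha>) \<alpha>"
    using primitive_on_backward[where w = "\<lambda>s. - \<alpha> s" and k = 0 and y = "\<lambda>t. - integral {t..b} \<alpha>"] by simp
  have "primitive_on a b (\<lambda>t. exp (- integral {t..b} \<alpha>)) (\<lambda>t. exp (- integral {t..b} \<alpha>) * \<alpha> t)"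
    by (rule primitive_on_chain[OF A]) (auto intro: DERIV_exp continuous_intros)
  from primitive_on_mult[OF this primitive_on_backward[OF w y]]
  have P: "primitive_on a b (\<lambda>t. exp (- integral {t..b} \<alpha>) * y t)
      (\<lambda>t. y t * (exp (- integral {t..b} \<alpha>) * \<alpha> t) + exp (- integral {t..b} \<alpha>) * - w t)" by simp
  have "y b - exp (- integral {t..b} \<alpha>) * y t = integral {t..b}
      (\<lambda>t. y t * (exp (- integral {t..b} \<alpha>) * \<alpha> t) + exp (- integral {t..b} \<alpha>) * - w t)"
    using primitive_on_diff[OF P, of t b] t by simp
  also have "\<dots> = integral {t..b} (\<lambda>s. - (exp (- integral {s..b} \<alpha>) * (w s - \<alpha> s * y s)))"
    by (intro arg_cong[where f = "integral {t..b}"]) (auto simp: algebra_simps)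
  finally show ?thesis using y[of b] t by simp
qed

subsection \<open>Comparison and existence\<close>

lemma absolutely_integrable_bounded_measurable:
  fixes f :: "real \<Rightarrow> real"
  assumes "f \<in> borel_measurable (lebesgue_on {a..b})" "\<And>t. t \<in> {a..b} \<Longrightarrow> \<bar>f t\<bar> \<le> M"
  shows "f absolutely_integrable_on {a..b}"
  by (rule measurable_bounded_by_integrable_imp_absolutely_integrable[where g = "\<lambda>_. M"])
    (use assms in auto)

lemma exp_integral_absolutely_integrable:
  fixes \<alpha> q :: "real \<Rightarrow> real"
  assumes "\<alpha> absolutely_integrable_on {a..b}" "q absolutely_integrable_on {a..b}"
  shows "(\<lambda>s. exp (- integral {s..b} \<alpha>) * q s) absolutely_integrable_on {a..b}"
  using assms
  by (intro absolutely_integrable_continuous_mult continuous_intros indefinite_integral_continuous_1'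
      set_lebesgue_integral_eq_integral(1))

text \<open>The difference quotient \<open>\<alpha> = \<beta> / y\<close> linearises the equation; where \<open>y = 0\<close> also \<open>\<beta> = 0\<close>,
  so the convention \<open>x / 0 = 0\<close> is harmless.\<close>

lemma backward_comparison:
  fixes a b k L C :: real and w y c \<beta> :: "real \<Rightarrow> real"
  assumes w: "w absolutely_integrable_on {a..b}"
    and y: "\<And>t. t \<in> {a..b} \<Longrightarrow> y t = k + integral {t..b} w"
    and c: "c absolutely_integrable_on {a..b}"
    and \<beta>: "\<beta> \<in> borel_measurable (lebesgue_on {a..b})"
      "\<And>t. t \<in> {a..b} \<Longrightarrow> \<bar>\<beta> t\<bar> \<le> L * \<bar>y t\<bar>"
      "\<And>t. t \<in> {a..b} \<Longrightarrow> \<beta> t - c t \<le> w t"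
    and "C \<le> k" "0 \<le> L"
    and bound: "\<And>\<alpha> t. \<alpha> \<in> borel_measurable (lebesgue_on {a..b}) \<Longrightarrow> (\<And>t. t \<in> {a..b} \<Longrightarrow> \<bar>\<alpha> t\<bar> \<le> L) \<Longrightarrow>
      t \<in> {a..b} \<Longrightarrow> integral {t..b} (\<lambda>s. exp (- integral {s..b} \<alpha>) * c s) \<le> C"
    and t: "t \<in> {a..b}"
  shows "0 \<le> y t"
proof -
  define \<alpha> where "\<alpha> = (\<lambda>s. \<beta> s / y s)"
  have "y \<in> borel_measurable (lebesgue_on {a..b})"
    using primitive_on_continuous[OF primitive_on_backward[OF w y]]
    by (intro continuous_imp_measurable_on_sets_lebesgue) auto
  then have meas: "\<alpha> \<in> borel_measurable (lebesgue_on {a..b})"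
    unfolding \<alpha>_def using \<beta>(1) by measurable
  have le: "\<bar>\<alpha> s\<bar> \<le> L" if "s \<in> {a..b}" for s
    using \<beta>(2)[OF that] \<open>0 \<le> L\<close> by (auto simp: \<alpha>_def divide_le_eq)
  have eq: "\<alpha> s * y s = \<beta> s" if "s \<in> {a..b}" for s
    using \<beta>(2)[OF that] by (auto simp: \<alpha>_def)
  have \<alpha>: "\<alpha> absolutely_integrable_on {a..b}"
    using meas le by (rule absolutely_integrable_bounded_measurable)
  have \<alpha>y: "(\<lambda>s. \<alpha> s * y s) absolutely_integrable_on {a..b}"
    using absolutely_integrable_continuous_mult[OF primitive_on_continuous[OF primitive_on_backward[OF w y]] \<alpha>]
    by (simp add: mult.commute)
  have sub: "f integrable_on {t..b}" if "f absolutely_integrable_on {a..b}" for f :: "real \<Rightarrow> real"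
    using t that absolutely_integrable_on_subinterval[OF that, of t b]
    by (intro set_lebesgue_integral_eq_integral(1)) auto
  have "0 \<le> k - integral {t..b} (\<lambda>s. exp (- integral {s..b} \<alpha>) * c s)"
    using bound[OF meas le t] \<open>C \<le> k\<close> by simp
  also have "\<dots> = k + integral {t..b} (\<lambda>s. exp (- integral {s..b} \<alpha>) * - c s)"
    by simp
  also have "\<dots> \<le> k + integral {t..b} (\<lambda>s. exp (- integral {s..b} \<alpha>) * (w s - \<alpha> s * y s))"
  proof (intro add_left_mono Henstock_Kurzweil_Integration.integral_le sub exp_integral_absolutely_integrable \<alpha>
      set_integral_diff(1) w \<alpha>y mult_left_mono)
    show "(\<lambda>s. - c s) absolutely_integrable_on {a..b}"
      using set_integrable_mult_right[of "-1" lebesgue _ c] c by simp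
    show "- c s \<le> w s - \<alpha> s * y s" if "s \<in> {t..b}" for s
      using \<beta>(3)[of s] eq[of s] that t by auto
  qed auto
  also have "\<dots> = exp (- integral {t..b} \<alpha>) * y t"
    using backward_linear_formula[OF w y \<alpha> t] by simp
  finally show ?thesis by (simp add: zero_le_mult_iff)
qed

text \<open>The weight \<open>exp (K * (t - b))\<close> with \<open>K > L\<close> turns the Picard map into a contraction on
  the whole interval.\<close>

lemma backward_Picard:
  fixes a b h L :: real and G :: "real \<Rightarrow> real \<Rightarrow> real"
  assumes "a \<le> b" "0 \<le> L"
    and lip: "\<And>t x y. t \<in> {a..b} \<Longrightarrow> \<bar>G t x - G t y\<bar> \<le> L * \<bar>x - y\<bar>"
    and int: "\<And>y. continuous_on {a..b} y \<Longrightarrow> (\<lambda>s. G s (y s)) absolutely_integrable_on {a..b}"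
  obtains y where "continuous_on {a..b} y"
    "\<And>t. t \<in> {a..b} \<Longrightarrow> y t = h + integral {t..b} (\<lambda>s. G s (y s))"
proof -
  define K where "K = L + 1"
  have K: "0 < K" "L < K" using \<open>0 \<le> L\<close> by (auto simp: K_def)
  define E where "E t = exp (K * (t - b))" for t
  define \<psi> where "\<psi> u t = E t * (h + integral {t..b} (\<lambda>s. G s (u s / E s)))" for u t
  define p where "p t = max a (min b t)" for t
  have p: "p t \<in> {a..b}" for t using \<open>a \<le> b\<close> by (auto simp: p_def)
  have pid: "p t = t" if "t \<in> {a..b}" for t using that by (auto simp: p_def)
  have pcont: "continuous_on A p" for A unfolding p_def by (intro continuous_intros)
  have E: "0 < E t" "continuous_on A E" for t A
    unfolding E_def by (auto intro!: continuous_intros)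
  have G: "(\<lambda>s. G s (u s / E s)) absolutely_integrable_on {a..b}" if "continuous_on {a..b} u" for u
    using that E by (intro int continuous_intros) (auto simp: less_imp_neq[symmetric])
  have Gsub: "(\<lambda>s. G s (u s / E s)) integrable_on {t..b}" if "continuous_on {a..b} u" "t \<in> {a..b}" for u t
    using absolutely_integrable_on_subinterval[OF G[OF that(1)], of t b] that
    by (intro set_lebesgue_integral_eq_integral(1)) auto
  have \<psi>: "continuous_on {a..b} (\<psi> u)" if "continuous_on {a..b} u" for u
    unfolding \<psi>_def using that
    by (intro continuous_intros E indefinite_integral_continuous_1' Gsub) (use \<open>a \<le> b\<close> in auto)
  have "(\<lambda>t. \<psi> (apply_bcontfun u) (p t)) \<in> bcontfun" for u
  proof -
    have "range (\<lambda>t. \<psi> (apply_bcontfun u) (p t)) \<subseteq> \<psi> (apply_bcontfun u) ` {a..b}" using p by auto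
    moreover have "bounded (\<psi> (apply_bcontfun u) ` {a..b})"
      by (intro compact_imp_bounded compact_continuous_image \<psi>) auto
    ultimately have "bounded (range (\<lambda>t. \<psi> (apply_bcontfun u) (p t)))" by (metis bounded_subset)
    then show ?thesis
      using p by (auto simp: bcontfun_def intro!: continuous_on_compose2[OF \<psi> pcont])
  qed
  then have \<Phi>: "apply_bcontfun (Bcontfun (\<lambda>t. \<psi> (apply_bcontfun u) (p t))) = (\<lambda>t. \<psi> (apply_bcontfun u) (p t))" for u
    by (simp add: Bcontfun_inverse)
  have contr: "\<bar>\<psi> u t - \<psi> v t\<bar> \<le> L / K * B"
    if uv: "continuous_on {a..b} u" "continuous_on {a..b} v" "\<And>s. s \<in> {a..b} \<Longrightarrow> \<bar>u s - v s\<bar> \<le> B" and t: "t \<in> {a..b}"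
    for u v t B
  proof -
    have B: "0 \<le> B" using uv(3)[OF t] by simp
    have "((\<lambda>s. exp (- (K * (s - b)))) has_integral
        (- exp (- (K * (b - b))) / K - - exp (- (K * (t - b))) / K)) {t..b}"
      using t K by (intro fundamental_theorem_of_calculus)
        (auto intro!: derivative_eq_intros simp flip: has_real_derivative_iff_has_vector_derivative)
    then have I: "((\<lambda>s. L * B * exp (- (K * (s - b)))) has_integral
        (L * B * (exp (- (K * (t - b))) / K - 1 / K))) {t..b}"
      by (intro has_integral_mult_right) simp
    have "norm (integral {t..b} (\<lambda>s. G s (u s / E s) - G s (v s / E s)))
        \<le> integral {t..b} (\<lambda>s. L * B * exp (- (K * (s - b))))"
    proof (intro Henstock_Kurzweil_Integration.integral_norm_bound_integral)
      fix s assume s: "s \<in> {t..b}"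
      have "norm (G s (u s / E s) - G s (v s / E s)) \<le> L * \<bar>u s / E s - v s / E s\<bar>"
        using lip[of s] s t by auto
      also have "\<dots> = L * (\<bar>u s - v s\<bar> * exp (- (K * (s - b))))"
        by (simp add: E_def exp_minus divide_inverse abs_mult flip: left_diff_distrib)
      also have "\<dots> \<le> L * (B * exp (- (K * (s - b))))"
        using uv(3)[of s] s t \<open>0 \<le> L\<close> by (intro mult_left_mono mult_right_mono) auto
      finally show "norm (G s (u s / E s) - G s (v s / E s)) \<le> L * B * exp (- (K * (s - b)))" by simp
    qed (use I Gsub uv t in \<open>auto intro: integrable_diff\<close>)
    also have "\<dots> = L * B * (exp (- (K * (t - b))) / K - 1 / K)" using I by (rule integral_unique)
    also have "\<dots> \<le> L * B * (exp (- (K * (t - b))) / K)"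
      using K B \<open>0 \<le> L\<close> by (intro mult_left_mono) auto
    finally have "E t * \<bar>integral {t..b} (\<lambda>s. G s (u s / E s) - G s (v s / E s))\<bar> \<le> E t * (L * B * (exp (- (K * (t - b))) / K))"
      using E by (intro mult_left_mono) (auto simp: less_imp_le)
    also have "\<dots> = L / K * B" by (simp add: E_def exp_minus)
    finally show ?thesis
      using Gsub[OF uv(1) t] Gsub[OF uv(2) t] E(1)[of t]
      by (simp add: \<psi>_def Henstock_Kurzweil_Integration.integral_diff abs_mult flip: right_diff_distrib)
  qed
  have "\<exists>!u. Bcontfun (\<lambda>t. \<psi> (apply_bcontfun u) (p t)) = u"
  proof (rule banach_fix_type[where c = "L / K"])
    show "0 \<le> L / K" "L / K < 1" using K \<open>0 \<le> L\<close> by auto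
    show "\<forall>u v. dist (Bcontfun (\<lambda>t. \<psi> (apply_bcontfun u) (p t))) (Bcontfun (\<lambda>t. \<psi> (apply_bcontfun v) (p t)))
        \<le> L / K * dist u v"
    proof (intro allI dist_bound)
      fix u v :: "real \<Rightarrow>\<^sub>C real" and t
      show "dist (Bcontfun (\<lambda>t. \<psi> (apply_bcontfun u) (p t)) t) (Bcontfun (\<lambda>t. \<psi> (apply_bcontfun v) (p t)) t)
        \<le> L / K * dist u v"
        unfolding \<Phi> dist_real_def using dist_bounded[of u _ v] p
        by (intro contr) (auto simp: dist_real_def)
    qed
  qed
  then obtain u where "Bcontfun (\<lambda>t. \<psi> (apply_bcontfun u) (p t)) = u" by blast
  then have u: "apply_bcontfun u t = \<psi> (apply_bcontfun u) (p t)" for t by (metis \<Phi>)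
  show ?thesis
  proof (rule that)
    show "continuous_on {a..b} (\<lambda>t. u t / E t)"
      using E by (intro continuous_intros) (auto simp: less_imp_neq[symmetric])
    show "u t / E t = h + integral {t..b} (\<lambda>s. G s (u s / E s))" if "t \<in> {a..b}" for t
      using u[of t] pid[OF that] E(1)[of t] by (simp add: \<psi>_def field_simps)
  qed
qed

subsection \<open>Sub- and supersolutions\<close>

lemma backward_ode_solution_iff:
  "backward_ode_solution T G h y \<longleftrightarrow> (\<lambda>s. G s (y s)) absolutely_integrable_on {0..T} \<and>
     (\<forall>t\<in>{0..T}. y t = h + integral {t..T} (\<lambda>s. G s (y s)))"
proof -
  have "(LINT s:{t..T}|lebesgue. G s (y s)) = integral {t..T} (\<lambda>s. G s (y s))"
    if "(\<lambda>s. G s (y s)) absolutely_integrable_on {0..T}" "t \<in> {0..T}" for t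
    using that(2) by (intro set_lebesgue_integral_eq_integral(2) absolutely_integrable_on_subinterval[OF that(1)]) auto
  then show ?thesis by (auto simp: backward_ode_solution_def)
qed

lemma backward_ode_solution_continuous:
  assumes "backward_ode_solution T G h y"
  shows "continuous_on {0..T} y"
  using primitive_on_backward[where w = "\<lambda>s. G s (y s)" and a = 0 and b = T and y = y and k = h] assms
  by (auto simp: backward_ode_solution_iff intro: primitive_on_continuous)

lemma discounted_set_integral:
  fixes \<alpha> c :: "real \<Rightarrow> real"
  assumes \<alpha>: "\<alpha> absolutely_integrable_on {a..b}" and c: "c absolutely_integrable_on {a..b}" and t: "t \<in> {a..b}"
  shows "(LINT s:{t..b}|lebesgue. exp (- (LINT r:{s..b}|lebesgue. \<alpha> r)) * c s)
    = integral {t..b} (\<lambda>s. exp (- integral {s..b} \<alpha>) * c s)"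
proof -
  have "(LINT r:{s..b}|lebesgue. \<alpha> r) = integral {s..b} \<alpha>" if "s \<in> {t..b}" for s
    using that t by (intro set_lebesgue_integral_eq_integral(2) absolutely_integrable_on_subinterval[OF \<alpha>]) auto
  then have "(LINT s:{t..b}|lebesgue. exp (- (LINT r:{s..b}|lebesgue. \<alpha> r)) * c s)
    = (LINT s:{t..b}|lebesgue. exp (- integral {s..b} \<alpha>) * c s)"
    by (intro set_lebesgue_integral_cong) auto
  also have "\<dots> = integral {t..b} (\<lambda>s. exp (- integral {s..b} \<alpha>) * c s)"
    using t by (intro set_lebesgue_integral_eq_integral(2)
        absolutely_integrable_on_subinterval[OF exp_integral_absolutely_integrable[OF \<alpha> c]]) auto
  finally show ?thesis .
qed

lemma borel_measurable_along_path:
  fixes F :: "real \<Rightarrow> real \<Rightarrow> real"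
  assumes "case_prod F \<in> borel_measurable (lebesgue_on {a..b} \<Otimes>\<^sub>M borel)" "continuous_on {a..b} y"
  shows "(\<lambda>s. F s (y s)) \<in> borel_measurable (lebesgue_on {a..b})"
proof -
  have "y \<in> borel_measurable (lebesgue_on {a..b})"
    using assms(2) by (intro continuous_imp_measurable_on_sets_lebesgue) auto
  then have "(\<lambda>s. (s, y s)) \<in> lebesgue_on {a..b} \<rightarrow>\<^sub>M lebesgue_on {a..b} \<Otimes>\<^sub>M borel"
    by (intro measurable_Pair) auto
  from measurable_compose[OF this assms(1)] show ?thesis by simp
qed

theorem lemma5p1:
  fixes T L h0 h1 h2 C1 C2 :: real
    and F0 F1 F2 :: "real \<Rightarrow> real \<Rightarrow> real"
    and c1 c2 y1 y2 :: "real \<Rightarrow> real"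
  assumes "T > 0"
    and F_measurable:
      "case_prod F0 \<in> borel_measurable (lebesgue_on {0..T} \<Otimes>\<^sub>M borel)"
      "case_prod F1 \<in> borel_measurable (lebesgue_on {0..T} \<Otimes>\<^sub>M borel)"
      "case_prod F2 \<in> borel_measurable (lebesgue_on {0..T} \<Otimes>\<^sub>M borel)"
    and c_integrable:
      "set_integrable lebesgue {0..T} c1"
      "set_integrable lebesgue {0..T} c2"
    and h_order: "h1 \<le> h0" "h0 \<le> h2"
    and F_order: "\<forall>t\<in>{0..T}. \<forall>y. F1 t y \<le> F0 t y \<and> F0 t y \<le> F2 t y"
    and y1: "backward_ode_solution T (\<lambda>s y. F1 s y + c1 s) (h1 - C1) y1"
      "bounded (y1 ` {0..T})"
    and y2: "backward_ode_solution T (\<lambda>s y. F2 s y - c2 s) (h2 + C2) y2"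
      "bounded (y2 ` {0..T})"
    and F_lipschitz: "\<forall>t\<in>{0..T}.
      lipschitz_on L (closed_segment (y1 t) (y2 t)) (F0 t) \<and>
      lipschitz_on L (closed_segment (y1 t) (y2 t)) (F1 t) \<and>
      lipschitz_on L (closed_segment (y1 t) (y2 t)) (F2 t)"
    and C_bound: "\<forall>\<alpha>. \<alpha> \<in> borel_measurable (lebesgue_on {0..T}) \<and> (\<forall>t\<in>{0..T}. \<bar>\<alpha> t\<bar> \<le> L) \<longrightarrow>
      (\<forall>t\<in>{0..T}.
        C1 \<ge> (LINT s:{t..T}|lebesgue. exp (- (LINT r:{s..T}|lebesgue. \<alpha> r)) * c1 s) \<and>
        C2 \<ge> (LINT s:{t..T}|lebesgue. exp (- (LINT r:{s..T}|lebesgue. \<alpha> r)) * c2 s))"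
  shows "\<exists>y0. backward_ode_solution T F0 h0 y0 \<and>
      (\<forall>t\<in>{0..T}. y1 t \<le> y0 t \<and> y0 t \<le> y2 t) \<and>
      (\<forall>z. backward_ode_solution T F0 h0 z \<and> (\<forall>t\<in>{0..T}. y1 t \<le> z t \<and> z t \<le> y2 t) \<longrightarrow>
         (\<forall>t\<in>{0..T}. z t = y0 t))"
proof -
  have L: "0 \<le> L" using bspec[OF F_lipschitz, of 0] \<open>T > 0\<close> by (auto dest: lipschitz_on_nonneg)
  have bound: "integral {t..T} (\<lambda>s. exp (- integral {s..T} \<alpha>) * c1 s) \<le> C1"
      "integral {t..T} (\<lambda>s. exp (- integral {s..T} \<alpha>) * c2 s) \<le> C2"
      "integral {t..T} (\<lambda>s. exp (- integral {s..T} \<alpha>) * (c1 s + c2 s)) \<le> C1 + C2"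
    if \<alpha>: "\<alpha> \<in> borel_measurable (lebesgue_on {0..T})" "\<And>t. t \<in> {0..T} \<Longrightarrow> \<bar>\<alpha> t\<bar> \<le> L" and t: "t \<in> {0..T}"
    for \<alpha> t
  proof -
    have \<alpha>I: "\<alpha> absolutely_integrable_on {0..T}"
      using \<alpha> by (rule absolutely_integrable_bounded_measurable)
    show c1: "integral {t..T} (\<lambda>s. exp (- integral {s..T} \<alpha>) * c1 s) \<le> C1"
      and c2: "integral {t..T} (\<lambda>s. exp (- integral {s..T} \<alpha>) * c2 s) \<le> C2"
      using C_bound \<alpha> t c_integrable by (auto simp flip: discounted_set_integral[OF \<alpha>I _ t])
    have "(\<lambda>s. exp (- integral {s..T} \<alpha>) * c s) integrable_on {t..T}" if "c absolutely_integrable_on {0..T}" for c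
      using t by (intro set_lebesgue_integral_eq_integral(1)
        absolutely_integrable_on_subinterval[OF exp_integral_absolutely_integrable[OF \<alpha>I that]]) auto
    then show "integral {t..T} (\<lambda>s. exp (- integral {s..T} \<alpha>) * (c1 s + c2 s)) \<le> C1 + C2"
      using c1 c2 c_integrable by (simp add: distrib_left Henstock_Kurzweil_Integration.integral_add)
  qed
  note y1I = y1(1)[unfolded backward_ode_solution_iff]
  note y2I = y2(1)[unfolded backward_ode_solution_iff]
  note y1c = backward_ode_solution_continuous[OF y1(1)]
  note y2c = backward_ode_solution_continuous[OF y2(1)]
  have sub: "f integrable_on {t..T}" if "f absolutely_integrable_on {0..T}" "t \<in> {0..T}" for f :: "real \<Rightarrow> real" and t
    using that(2) absolutely_integrable_on_subinterval[OF that(1), of t T]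
    by (intro set_lebesgue_integral_eq_integral(1)) auto
  have diff: "(\<lambda>s. f s - g s) absolutely_integrable_on {0..T} \<and>
      (\<forall>t\<in>{0..T}. u t - v t = (k - l) + integral {t..T} (\<lambda>s. f s - g s))"
    if "f absolutely_integrable_on {0..T} \<and> (\<forall>t\<in>{0..T}. u t = k + integral {t..T} f)"
      "g absolutely_integrable_on {0..T} \<and> (\<forall>t\<in>{0..T}. v t = l + integral {t..T} g)"
    for f g u v :: "real \<Rightarrow> real" and k l
    using that sub by (auto simp: Henstock_Kurzweil_Integration.integral_diff)
  have lip: "\<bar>F0 t x - F0 t y\<bar> \<le> L * \<bar>x - y\<bar>" "\<bar>F1 t x - F1 t y\<bar> \<le> L * \<bar>x - y\<bar>" "\<bar>F2 t x - F2 t y\<bar> \<le> L * \<bar>x - y\<bar>"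
    if "t \<in> {0..T}" "x \<in> closed_segment (y1 t) (y2 t)" "y \<in> closed_segment (y1 t) (y2 t)" for t x y
    using bspec[OF F_lipschitz that(1)] by (auto simp flip: dist_real_def intro: lipschitz_onD[OF _ that(2,3)])
  have y12: "y1 t \<le> y2 t" if t: "t \<in> {0..T}" for t
  proof -
    note D = diff[OF y2I y1I]
    have "0 \<le> y2 t - y1 t"
    proof (rule backward_comparison[where y = "\<lambda>s. y2 s - y1 s" and \<beta> = "\<lambda>s. F2 s (y2 s) - F2 s (y1 s)" and c = "\<lambda>s. c1 s + c2 s" and C = "C1 + C2" and L = L])
      show "(\<lambda>s. (F2 s (y2 s) - c2 s) - (F1 s (y1 s) + c1 s)) absolutely_integrable_on {0..T}"
        using D by blast
      show "y2 t - y1 t = (h2 + C2 - (h1 - C1)) + integral {t..T} (\<lambda>s. (F2 s (y2 s) - c2 s) - (F1 s (y1 s) + c1 s))"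
        if "t \<in> {0..T}" for t using D that by blast
      show "(\<lambda>s. F2 s (y2 s) - F2 s (y1 s)) \<in> borel_measurable (lebesgue_on {0..T})"
        using borel_measurable_along_path F_measurable y1c y2c by (intro borel_measurable_diff)
      show "F2 t (y2 t) - F2 t (y1 t) - (c1 t + c2 t) \<le> F2 t (y2 t) - c2 t - (F1 t (y1 t) + c1 t)"
        if "t \<in> {0..T}" for t
        using F_order that by (smt (verit))
    qed (use c_integrable h_order L bound lip t in auto)
    then show ?thesis by simp
  qed
  have seg: "closed_segment (y1 t) (y2 t) = {y1 t..y2 t}" if "t \<in> {0..T}" for t
    using y12[OF that] by (simp add: closed_segment_eq_real_ivl)
  define cl where "cl t x = max (y1 t) (min (y2 t) x)" for t x
  have cl_in: "cl t x \<in> closed_segment (y1 t) (y2 t)" if "t \<in> {0..T}" for t x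
    using seg y12 that by (auto simp: cl_def)
  have cl_id: "cl t x = x" if "y1 t \<le> x" "x \<le> y2 t" for t x
    using that by (auto simp: cl_def)
  have cl_lip: "\<bar>cl t x - cl t y\<bar> \<le> \<bar>x - y\<bar>" for t x y
    unfolding cl_def by (auto simp: max_def min_def)
  define G where "G t x = F0 t (cl t x)" for t x
  have G_lip: "\<bar>G t x - G t y\<bar> \<le> L * \<bar>x - y\<bar>" if "t \<in> {0..T}" for t x y
  proof -
    have "\<bar>G t x - G t y\<bar> \<le> L * \<bar>cl t x - cl t y\<bar>"
      unfolding G_def using lip(1) cl_in that by blast
    also have "\<dots> \<le> L * \<bar>x - y\<bar>" using cl_lip L by (rule mult_left_mono)
    finally show ?thesis .
  qed
  have G_meas: "(\<lambda>s. G s (y s)) \<in> borel_measurable (lebesgue_on {0..T})" if "continuous_on {0..T} y" for y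
    unfolding G_def cl_def using F_measurable(1) that y1c y2c
    by (intro borel_measurable_along_path continuous_intros)
  have F1I: "(\<lambda>s. F1 s (y1 s)) absolutely_integrable_on {0..T}"
    using set_integral_diff(1)[OF y1I[THEN conjunct1] c_integrable(1)] by simp
  have F2I: "(\<lambda>s. F2 s (y2 s)) absolutely_integrable_on {0..T}"
    using set_integral_add(1)[OF y2I[THEN conjunct1] c_integrable(2)] by simp
  have G_int: "(\<lambda>s. G s (y s)) absolutely_integrable_on {0..T}" if y: "continuous_on {0..T} y" for y
  proof (rule measurable_bounded_by_integrable_imp_absolutely_integrable
      [where g = "\<lambda>s. \<bar>F1 s (y1 s)\<bar> + \<bar>F2 s (y2 s)\<bar> + 2 * L * (y2 s - y1 s)"])
    have "(\<lambda>s. 2 * L * (y2 s - y1 s)) integrable_on {0..T}"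
      by (intro integrable_continuous_real continuous_intros y1c y2c)
    moreover have "(\<lambda>s. \<bar>F1 s (y1 s)\<bar> + \<bar>F2 s (y2 s)\<bar>) integrable_on {0..T}"
      by (intro set_lebesgue_integral_eq_integral(1) set_integral_add(1) set_integrable_abs F1I F2I)
    ultimately show "(\<lambda>s. \<bar>F1 s (y1 s)\<bar> + \<bar>F2 s (y2 s)\<bar> + 2 * L * (y2 s - y1 s)) integrable_on {0..T}"
      by (rule integrable_add[rotated])
    fix t assume t: "t \<in> {0..T}"
    let ?x = "cl t (y t)"
    have x: "y1 t \<le> ?x" "?x \<le> y2 t" using cl_in[OF t] seg[OF t] by auto
    have "\<bar>F1 t ?x - F1 t (y1 t)\<bar> \<le> L * \<bar>?x - y1 t\<bar>" "\<bar>F2 t ?x - F2 t (y2 t)\<bar> \<le> L * \<bar>?x - y2 t\<bar>"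
      using lip cl_in t by auto
    moreover have "L * \<bar>?x - y1 t\<bar> \<le> L * (y2 t - y1 t)" "L * \<bar>?x - y2 t\<bar> \<le> L * (y2 t - y1 t)"
      using x L by (auto intro!: mult_left_mono)
    moreover have "F1 t ?x \<le> F0 t ?x" "F0 t ?x \<le> F2 t ?x" using F_order t by auto
    moreover have "0 \<le> L * (y2 t - y1 t)" using x L by auto
    ultimately have "\<bar>F0 t ?x\<bar> \<le> \<bar>F1 t (y1 t)\<bar> + \<bar>F2 t (y2 t)\<bar> + 2 * (L * (y2 t - y1 t))" by linarith
    then show "norm (G t (y t)) \<le> \<bar>F1 t (y1 t)\<bar> + \<bar>F2 t (y2 t)\<bar> + 2 * L * (y2 t - y1 t)"
      by (simp add: G_def)
  qed (use G_meas y in auto)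
  obtain y0 where y0c: "continuous_on {0..T} y0"
    and "\<And>t. t \<in> {0..T} \<Longrightarrow> y0 t = h0 + integral {t..T} (\<lambda>s. G s (y0 s))"
    by (rule backward_Picard[where h = h0, OF less_imp_le[OF \<open>T > 0\<close>] L G_lip G_int]) (assumption | blast)+
  then have y0I: "(\<lambda>s. G s (y0 s)) absolutely_integrable_on {0..T} \<and>
      (\<forall>t\<in>{0..T}. y0 t = h0 + integral {t..T} (\<lambda>s. G s (y0 s)))"
    using G_int by auto
  have lower: "y1 t \<le> y0 t" if t: "t \<in> {0..T}" for t
  proof -
    note D = diff[OF y0I y1I]
    have "0 \<le> y0 t - y1 t"
    proof (rule backward_comparison[where y = "\<lambda>s. y0 s - y1 s" and \<beta> = "\<lambda>s. G s (y0 s) - G s (y1 s)" and c = c1 and C = C1 and L = L])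
      show "(\<lambda>s. G s (y0 s) - (F1 s (y1 s) + c1 s)) absolutely_integrable_on {0..T}"
        using D by blast
      show "y0 t - y1 t = (h0 - (h1 - C1)) + integral {t..T} (\<lambda>s. G s (y0 s) - (F1 s (y1 s) + c1 s))"
        if "t \<in> {0..T}" for t using D that by blast
      show "(\<lambda>s. G s (y0 s) - G s (y1 s)) \<in> borel_measurable (lebesgue_on {0..T})"
        using G_meas y0c y1c by (intro borel_measurable_diff)
      show "G t (y0 t) - G t (y1 t) - c1 t \<le> G t (y0 t) - (F1 t (y1 t) + c1 t)"
        if "t \<in> {0..T}" for t
        using F_order that cl_id[of t "y1 t"] y12[OF that] by (simp add: G_def)
    qed (use c_integrable h_order L bound G_lip t in auto)
    then show ?thesis by simp
  qed
  have upper: "y0 t \<le> y2 t" if t: "t \<in> {0..T}" for t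
  proof -
    note D = diff[OF y2I y0I]
    have "0 \<le> y2 t - y0 t"
    proof (rule backward_comparison[where y = "\<lambda>s. y2 s - y0 s" and \<beta> = "\<lambda>s. G s (y2 s) - G s (y0 s)" and c = c2 and C = C2 and L = L])
      show "(\<lambda>s. (F2 s (y2 s) - c2 s) - G s (y0 s)) absolutely_integrable_on {0..T}"
        using D by blast
      show "y2 t - y0 t = (h2 + C2 - h0) + integral {t..T} (\<lambda>s. (F2 s (y2 s) - c2 s) - G s (y0 s))"
        if "t \<in> {0..T}" for t using D that by blast
      show "(\<lambda>s. G s (y2 s) - G s (y0 s)) \<in> borel_measurable (lebesgue_on {0..T})"
        using G_meas y0c y2c by (intro borel_measurable_diff)
      show "G t (y2 t) - G t (y0 t) - c2 t \<le> (F2 t (y2 t) - c2 t) - G t (y0 t)"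
        if "t \<in> {0..T}" for t
        using F_order that cl_id[of t "y2 t"] y12[OF that] by (simp add: G_def)
    qed (use c_integrable h_order L bound G_lip t in auto)
    then show ?thesis by simp
  qed
  have G_eq: "F0 s (z s) = G s (z s)" if "\<forall>t\<in>{0..T}. y1 t \<le> z t \<and> z t \<le> y2 t" "s \<in> {0..T}" for s z
    using that cl_id by (auto simp: G_def)
  have sol_iff: "backward_ode_solution T F0 h0 z \<longleftrightarrow> backward_ode_solution T G h0 z"
    if "\<forall>t\<in>{0..T}. y1 t \<le> z t \<and> z t \<le> y2 t" for z
  proof -
    have "set_integrable lebesgue {0..T} (\<lambda>s. F0 s (z s)) \<longleftrightarrow> set_integrable lebesgue {0..T} (\<lambda>s. G s (z s))"
      using G_eq[OF that] by (intro set_integrable_cong) auto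
    moreover have "(LINT s:{t..T}|lebesgue. F0 s (z s)) = (LINT s:{t..T}|lebesgue. G s (z s))"
      if "t \<in> {0..T}" for t
      using G_eq[OF \<open>\<forall>t\<in>{0..T}. y1 t \<le> z t \<and> z t \<le> y2 t\<close>] that by (intro set_lebesgue_integral_cong) auto
    ultimately show ?thesis by (simp add: backward_ode_solution_def)
  qed
  have G_le: "u t \<le> v t"
    if "backward_ode_solution T G h0 u" "backward_ode_solution T G h0 v" and t: "t \<in> {0..T}" for u v t
  proof -
    note D = diff[OF that(2,1)[unfolded backward_ode_solution_iff]]
    have "0 \<le> v t - u t"
    proof (rule backward_comparison[where y = "\<lambda>s. v s - u s" and \<beta> = "\<lambda>s. G s (v s) - G s (u s)" and c = "\<lambda>_. 0" and C = 0 and L = L])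
      show "(\<lambda>s. G s (v s) - G s (u s)) absolutely_integrable_on {0..T}"
        using D by blast
      show "v t - u t = (h0 - h0) + integral {t..T} (\<lambda>s. G s (v s) - G s (u s))"
        if "t \<in> {0..T}" for t using D that by blast
      show "(\<lambda>s. G s (v s) - G s (u s)) \<in> borel_measurable (lebesgue_on {0..T})"
        using that(1,2)[THEN backward_ode_solution_continuous] G_meas by (intro borel_measurable_diff)
    qed (use L G_lip t in auto)
    then show ?thesis by simp
  qed
  have between: "\<forall>t\<in>{0..T}. y1 t \<le> y0 t \<and> y0 t \<le> y2 t" using lower upper by blast
  have "backward_ode_solution T G h0 y0" using y0I by (simp add: backward_ode_solution_iff)
  then show ?thesis
    using between sol_iff G_le by (intro exI[of _ y0]) (auto intro: order_antisym)
qed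

end
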